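(* Suppose that $F=f+g$ is bounded from below and $\Omega_{x_0}=\{x\in\mathcal{M}:F(x)\le F(x_0)\}$ is compact, and that $g$ is convex and Lipschitz continuous with constant $L_g$ in the Euclidean sense. Suppose there exists a constant $\rho>0$ such that for any $x\in\Omega_{x_0}$ it holds that $\Omega_{x_0}\subseteq R_x(\mathcal{B}(0_x,\rho))$. Let $\phi:\mathbb{R}\to\mathbb{R}$ be nondecreasing with $\phi(0)=0$. Then, if $\tilde L$ is sufficiently large (i.e. there is a threshold such that for every $\tilde L$ above it the following holds), for every $x\in\Omega_{x_0}$ and every $\hat\Lambda\in\mathbb{R}^{n-d}$ such that the search direction $\hat\eta_x=P_{\mathrm{T}_x\mathcal{M}}(v(\hat\Lambda))$ satisfies $$\|\Psi(\hat\Lambda)\|\le\min(\phi(\|\hat\eta_x\|),0.5),$$ there is a stationary point $\eta_x^*$ of $\ell_x$ with $$\|\hat\eta_x-\eta_x^*\|\le\tilde q(\|\hat\eta_x\|),$$ where $$\tilde q(t)=\frac{2L_g\varkappa_2}{\tilde L-2L_g\varkappa_2}\,t+\sqrt{\frac{4\tilde L L_g\varkappa_2-4L_g^2\varkappa_2^2}{(\tilde L-2L_g\varkappa_2)^2}\,t^2+\frac{4\vartheta}{\tilde L-2L_g\varkappa_2}\min(\phi(t),0.5)}.$$ Here $\varkappa_2$ and $\vartheta$ are the constants defined in the context.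
   Context: $\mathcal{M}$ is a $d$-dimensional embedded submanifold of $\mathbb{R}^n$ (or a quotient manifold whose total space is an embedded submanifold of $\mathbb{R}^n$, in which case $\mathrm{T}_x\mathcal{M}$ is read as the horizontal space at $x$), with the Euclidean metric $\langle\cdot,\cdot\rangle_{\mathrm F}$ as Riemannian metric and $\|\cdot\|$ the induced norm; $\mathbb{R}^n$ may also denote a matrix or tensor space. $F=f+g$ with $f$ differentiable and $g$ continuous, possibly nonsmooth; $\mathrm{grad} f$ is the Riemannian gradient. $R$ is a retraction: a smooth map $R:\mathrm{T}\mathcal{M}\to\mathcal{M}$, defined on the whole tangent bundle, with $R_x(0_x)=x$ and $\frac{d}{dt}R_x(t\eta_x)|_{t=0}=\eta_x$, where $R_x$ is its restriction to $\mathrm{T}_x\mathcal{M}$. $\mathcal{B}(0_x,\rho)=\{\xi\in \mathrm{T}_x\mathcal{M}:\|\xi\|<\rho\}$. $P_{\mathrm{T}_x\mathcal{M}}$ is the orthogonal projection onto $\mathrm{T}_x\mathcal{M}$. $B_x^T:\mathbb{R}^n\to\mathbb{R}^{n-d}$, $v\mapsto(\langle b_1,v\rangle_{\mathrm F},\dots,\langle b_{n-d},v\rangle_{\mathrm F})^T$, where $b_1,\dots,b_{n-d}$ is an orthonormal basis of the normal space at $x$ (so $\mathrm{T}_x\mathcal{M}=\{\eta:B_x^T\eta=0\}$), and $B_x$ is its adjoint. For $\tilde L>0$ and $z\in\mathbb{R}^n$, $$\mathrm{Prox}_{g/\tilde L}(z)=\mathrm{arg\,min}_{v\in\mathbb{R}^n}\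 \tfrac12\|v-z\|^2+\tfrac1{\tilde L}g(v),$$ and for $\Lambda\in\mathbb{R}^{n-d}$, $$v(\Lambda)=\mathrm{Prox}_{g/\tilde L}\left(x-\tfrac1{\tilde L}(\mathrm{grad} f(x)-B_x\Lambda)\right)-x,\qquad \Psi(\Lambda)=B_x^Tv(\Lambda).$$ The Riemannian proximal mapping objective is $\ell_x(\eta)=\langle\mathrm{grad} f(x),\eta\rangle_{\mathrm F}+\frac{\tilde L}2\|\eta\|^2+g(R_x(\eta))$, $\eta\in \mathrm{T}_x\mathcal{M}$; a stationary point $\eta$ of $\ell_x$ is one with $0\in\partial\ell_x(\eta)$ ($\partial$ the Clarke subdifferential on $\mathrm{T}_x\mathcal{M}$). Constants: $\varkappa_2$ is a constant such that $\|R_x(\eta_x)-x-\eta_x\|\le\varkappa_2\|\eta_x\|^2$ for all $x\in\Omega_{x_0}$ and $\eta_x\in \mathrm{T}_x\mathcal{M}$ with $\|\eta_x\|\le\rho$. $U_f$ is a constant with $\|\mathrm{grad} f(x)\|<U_f$ for all $x\in\Omega_{x_0}$. $\vartheta=U_f+(\rho+1)\tilde L+L_g$. *)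

theory Defs
  imports "HOL-Analysis.Analysis"
begin

section \<open>Smooth maps and embedded submanifolds of a Euclidean space\<close>

text \<open>\<open>C\<^sup>k\<close> regularity by iterated directional derivatives; only meant for open \<open>S\<close>.\<close>

primrec Ck_on :: "nat \<Rightarrow> 'a::euclidean_space set \<Rightarrow> ('a \<Rightarrow> 'b::euclidean_space) \<Rightarrow> bool" where
  "Ck_on 0 S f \<longleftrightarrow> continuous_on S f"
| "Ck_on (Suc k) S f \<longleftrightarrow>
     (\<forall>x\<in>S. f differentiable (at x)) \<and> (\<forall>v. Ck_on k S (\<lambda>x. frechet_derivative f (at x) v))"

definition smooth_on :: "'a::euclidean_space set \<Rightarrow> ('a \<Rightarrow> 'b::euclidean_space) \<Rightarrow> bool" where
  "smooth_on S f \<longleftrightarrow> (\<forall>k. Ck_on k S f)"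

text \<open>Smoothness on a set that need not be open (typically a submanifold): local existence of
  smooth extensions.\<close>

definition smooth_map_on :: "'a::euclidean_space set \<Rightarrow> ('a \<Rightarrow> 'b::euclidean_space) \<Rightarrow> bool" where
  "smooth_map_on A f \<longleftrightarrow>
     (\<forall>p\<in>A. \<exists>U h. open U \<and> p \<in> U \<and> smooth_on U h \<and> (\<forall>q\<in>A \<inter> U. h q = f q))"

text \<open>Slice charts. The model space \<open>\<real>\<^sup>d\<close> is an arbitrary \<open>d\<close>-dimensional linear subspace \<open>E\<close>.\<close>

definition embedded_submanifold :: "'a::euclidean_space set \<Rightarrow> nat \<Rightarrow> bool" where
  "embedded_submanifold M d \<longleftrightarrow>
     (\<forall>x\<in>M. \<exists>U V \<phi> \<psi> (E :: 'a set). open U \<and> open V \<and> x \<in> U \<and> homeomorphism U V \<phi> \<psi> \<and>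
        smooth_on U \<phi> \<and> smooth_on V \<psi> \<and> subspace E \<and> dim E = d \<and> \<phi> ` (M \<inter> U) = E \<inter> V)"

definition tangent_space :: "'a::euclidean_space set \<Rightarrow> 'a \<Rightarrow> 'a set" where
  "tangent_space M x =
     {v. \<exists>(c::real \<Rightarrow> 'a) e. e > 0 \<and> smooth_on {-e<..<e} c \<and> c ` {-e<..<e} \<subseteq> M \<and> c 0 = x \<and>
         (c has_vector_derivative v) (at 0)}"

section \<open>Quotient manifolds with embedded total space\<close>

text \<open>A quotient of \<open>M\<close> is given by an equivalence relation \<open>r\<close> on the total space \<open>M\<close>, and all data
  on the quotient are represented by their lifts to \<open>M\<close>. An embedded submanifold is represented by
  \<open>r = Id_on M\<close>; the lemmas below show what the notions reduce to in that case.\<close>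

definition horizontal_space :: "'a::euclidean_space set \<Rightarrow> ('a \<times> 'a) set \<Rightarrow> 'a \<Rightarrow> 'a set" where
  "horizontal_space M r x = tangent_space M x \<inter> (tangent_space (r `` {x}) x)\<^sup>\<bottom>"

definition quotient_topology :: "'a::topological_space set \<Rightarrow> ('a \<times> 'a) set \<Rightarrow> 'a set topology" where
  "quotient_topology M r = topology (\<lambda>\<U>. \<U> \<subseteq> M // r \<and> openin (top_of_set M) (\<Union>\<U>))"

text \<open>A chart of the quotient, composed with the canonical projection: a smooth submersion \<open>q\<close>, on a
  saturated open subset \<open>U\<close> of \<open>M\<close>, into a model space \<open>E\<close> of dimension \<open>d\<close>, whose fibres are
  the equivalence classes. The derivative within \<open>M\<close> is determined on tangent vectors only, which is
  the only place where it is used here and below.\<close>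

definition quotient_chart ::
  "'a::euclidean_space set \<Rightarrow> ('a \<times> 'a) set \<Rightarrow> nat \<Rightarrow> 'a set \<Rightarrow> ('a \<Rightarrow> 'a) \<Rightarrow> bool" where
  "quotient_chart M r d U q \<longleftrightarrow>
     openin (top_of_set M) U \<and> r `` U \<subseteq> U \<and> smooth_map_on U q \<and>
     (\<exists>E. subspace E \<and> dim E = d \<and> q ` U \<subseteq> E \<and>
        (\<forall>x\<in>U. frechet_derivative q (at x within M) ` tangent_space M x = E)) \<and>
     (\<forall>x\<in>U. \<forall>y\<in>U. (x, y) \<in> r \<longleftrightarrow> q x = q y)"

definition quotient_manifold :: "'a::euclidean_space set \<Rightarrow> ('a \<times> 'a) set \<Rightarrow> nat \<Rightarrow> bool" where
  "quotient_manifold M r d \<longleftrightarrow>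
     (\<exists>D. embedded_submanifold M D) \<and> equiv M r \<and> Hausdorff_space (quotient_topology M r) \<and>
     (\<forall>x\<in>M. \<exists>U q. x \<in> U \<and> quotient_chart M r d U q)"

text \<open>The horizontal vectors \<open>\<xi>\<close> at \<open>x\<close> and \<open>\<zeta>\<close> at \<open>y\<close> lift the same tangent vector of the
  quotient.\<close>

definition same_tangent ::
  "'a::euclidean_space set \<Rightarrow> ('a \<times> 'a) set \<Rightarrow> nat \<Rightarrow> 'a \<Rightarrow> 'a \<Rightarrow> 'a \<Rightarrow> 'a \<Rightarrow> bool" where
  "same_tangent M r d x \<xi> y \<zeta> \<longleftrightarrow>
     (x, y) \<in> r \<and> \<xi> \<in> horizontal_space M r x \<and> \<zeta> \<in> horizontal_space M r y \<and>
     (\<exists>U q. x \<in> U \<and> quotient_chart M r d U q \<and>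
        frechet_derivative q (at x within M) \<xi> = frechet_derivative q (at y within M) \<zeta>)"

text \<open>The Euclidean inner product of horizontal lifts is independent of the representative, i.e. it
  induces a Riemannian metric on the quotient.\<close>

definition riemannian_quotient :: "'a::euclidean_space set \<Rightarrow> ('a \<times> 'a) set \<Rightarrow> nat \<Rightarrow> bool" where
  "riemannian_quotient M r d \<longleftrightarrow> quotient_manifold M r d \<and>
     (\<forall>x y \<xi>\<^sub>1 \<xi>\<^sub>2 \<zeta>\<^sub>1 \<zeta>\<^sub>2. same_tangent M r d x \<xi>\<^sub>1 y \<zeta>\<^sub>1 \<and> same_tangent M r d x \<xi>\<^sub>2 y \<zeta>\<^sub>2 \<longrightarrow>
        \<xi>\<^sub>1 \<bullet> \<xi>\<^sub>2 = \<zeta>\<^sub>1 \<bullet> \<zeta>\<^sub>2)"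

lemma tangent_space_singleton: "tangent_space {x} x = {0}"
proof -
  have "v = 0" if "e > 0" "c ` {-e<..<e} \<subseteq> {x}" "(c has_vector_derivative v) (at 0)"
    for v e and c :: "real \<Rightarrow> 'a"
  proof -
    have "((\<lambda>_. x) has_vector_derivative v) (at 0)"
    proof (rule has_vector_derivative_transform_within_open[OF that(3), of "{-e<..<e}"])
      show "open {-e<..<e}" "0 \<in> {-e<..<e}" using that(1) by auto
      show "\<And>t. t \<in> {-e<..<e} \<Longrightarrow> c t = x" using that(2) by blast
    qed
    then show ?thesis
      using has_vector_derivative_const vector_derivative_unique_at by blast
  qed
  moreover have "0 \<in> tangent_space {x} x"
  proof -
    have "Ck_on k S (\<lambda>_. a)" for k and S :: "real set" and a :: 'a
      by (induction k arbitrary: a) (auto simp: frechet_derivative_const)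
    then have "smooth_on {-1<..<1::real} (\<lambda>_. x)"
      by (simp add: smooth_on_def)
    then show ?thesis
      unfolding tangent_space_def
      by (intro CollectI exI[of _ "\<lambda>_. x"] exI[of _ 1]) auto
  qed
  ultimately show ?thesis
    unfolding tangent_space_def by blast
qed

lemma horizontal_space_Id_on:
  assumes "x \<in> M"
  shows "horizontal_space M (Id_on M) x = tangent_space M x"
proof -
  have "Id_on M `` {x} = {x}" using assms by auto
  then show ?thesis
    by (auto simp: horizontal_space_def tangent_space_singleton orthogonal_comp_def orthogonal_def)
qed

lemma openin_quotient_topology:
  assumes "equiv M r"
  shows "openin (quotient_topology M r) \<U> \<longleftrightarrow> \<U> \<subseteq> M // r \<and> openin (top_of_set M) (\<Union>\<U>)"
proof -
  have Int: "\<Union>(\<S> \<inter> \<T>) = \<Union>\<S> \<inter> \<Union>\<T>" if "\<S> \<subseteq> M // r" "\<T> \<subseteq> M // r" for \<S> \<T>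
    using quotient_disj[OF assms] that by blast
  have "istopology (\<lambda>\<U>. \<U> \<subseteq> M // r \<and> openin (top_of_set M) (\<Union>\<U>))"
    unfolding istopology_def
  proof (intro conjI allI impI)
    fix \<S> \<T> assume "\<S> \<subseteq> M // r \<and> openin (top_of_set M) (\<Union>\<S>)" "\<T> \<subseteq> M // r \<and> openin (top_of_set M) (\<Union>\<T>)"
    then show "\<S> \<inter> \<T> \<subseteq> M // r" "openin (top_of_set M) (\<Union>(\<S> \<inter> \<T>))"
      by (auto simp: Int)
  next
    fix \<K> assume a: "\<forall>K\<in>\<K>. K \<subseteq> M // r \<and> openin (top_of_set M) (\<Union>K)"
    then show "\<Union>\<K> \<subseteq> M // r" by blast
    have "\<Union>(\<Union>\<K>) = \<Union>(Union ` \<K>)" by blast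
    then show "openin (top_of_set M) (\<Union>(\<Union>\<K>))"
      using a by (auto intro: openin_Union)
  qed
  then show ?thesis
    by (simp add: quotient_topology_def topology_inverse')
qed

lemma compactin_quotient_topology_Id_on:
  assumes "S \<subseteq> M"
  shows "compactin (quotient_topology M (Id_on M)) (S // Id_on M) \<longleftrightarrow> compact S"
proof -
  let ?X = "quotient_topology M (Id_on M)"
  have eq: "equiv M (Id_on M)"
    by (auto simp: equiv_def refl_on_def sym_def trans_def)
  have quot: "A // Id_on M = (\<lambda>x. {x}) ` A" if "A \<subseteq> M" for A
    using that by (auto simp: quotient_def)
  have op: "openin ?X \<U> \<longleftrightarrow> \<U> \<subseteq> (\<lambda>x. {x}) ` M \<and> openin (top_of_set M) (\<Union>\<U>)" for \<U>
    by (simp add: openin_quotient_topology[OF eq] quot)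
  have im: "openin ?X ((\<lambda>x. {x}) ` U) \<longleftrightarrow> openin (top_of_set M) U" for U
    by (auto simp: op dest: openin_imp_subset)
  have top: "topspace ?X = (\<lambda>x. {x}) ` M"
  proof
    show "topspace ?X \<subseteq> (\<lambda>x. {x}) ` M" using op[of "topspace ?X"] by simp
    show "(\<lambda>x. {x}) ` M \<subseteq> topspace ?X" by (intro openin_subset) (simp add: im)
  qed
  have "homeomorphic_map (top_of_set M) ?X (\<lambda>x. {x})"
  proof (subst homeomorphic_eq_everything_map, intro conjI)
    show cont: "continuous_map (top_of_set M) ?X (\<lambda>x. {x})"
      unfolding continuous_map_def
    proof (intro conjI allI impI)
      show "(\<lambda>x. {x}) \<in> topspace (top_of_set M) \<rightarrow> topspace ?X" by (auto simp: top)
      fix \<U> assume "openin ?X \<U>"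
      then have "\<U> \<subseteq> (\<lambda>x. {x}) ` M" "openin (top_of_set M) (\<Union>\<U>)" by (auto simp: op)
      moreover from this(1) have "{x \<in> topspace (top_of_set M). {x} \<in> \<U>} = \<Union>\<U>" by auto
      ultimately show "openin (top_of_set M) {x \<in> topspace (top_of_set M). {x} \<in> \<U>}" by simp
    qed
    show opn: "open_map (top_of_set M) ?X (\<lambda>x. {x})"
      by (simp add: open_map_def im)
    show "(\<lambda>x. {x}) ` topspace (top_of_set M) = topspace ?X" by (simp add: top)
    show inj: "inj_on (\<lambda>x. {x}) (topspace (top_of_set M))" by (simp add: inj_on_def)
    show "closed_map (top_of_set M) ?X (\<lambda>x. {x})"
      by (rule bijective_open_imp_closed_map[OF opn _ inj]) (simp add: top)
  qed
  then have "compactin ?X ((\<lambda>x. {x}) ` S) \<longleftrightarrow> compactin (top_of_set M) S"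
    by (rule homeomorphic_map_compactness) (use assms in auto)
  then show ?thesis
    using assms by (simp add: quot compactin_subtopology)
qed

section \<open>Retractions, gradients and stationarity\<close>

text \<open>\<open>R x\<close> is the restriction of the retraction to the tangent (horizontal) space at \<open>x\<close>; values of
  \<open>R\<close> outside the tangent (horizontal) bundle are irrelevant. The last condition says that the lift
  descends to the quotient.\<close>

definition retraction_on ::
  "'a::euclidean_space set \<Rightarrow> ('a \<times> 'a) set \<Rightarrow> nat \<Rightarrow> ('a \<Rightarrow> 'a \<Rightarrow> 'a) \<Rightarrow> bool" where
  "retraction_on M r d R \<longleftrightarrow>
     (\<forall>x\<in>M. \<forall>\<eta>\<in>horizontal_space M r x. R x \<eta> \<in> M) \<and>
     smooth_map_on (SIGMA x:M. horizontal_space M r x) (\<lambda>(x, \<eta>). R x \<eta>) \<and>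
     (\<forall>x\<in>M. R x 0 = x) \<and>
     (\<forall>x\<in>M. \<forall>\<eta>\<in>horizontal_space M r x.
        ((\<lambda>t. R x (t *\<^sub>R \<eta>)) has_vector_derivative \<eta>) (at 0)) \<and>
     (\<forall>x y \<xi> \<zeta>. same_tangent M r d x \<xi> y \<zeta> \<longrightarrow> (R x \<xi>, R y \<zeta>) \<in> r)"

definition riem_grad ::
  "'a::euclidean_space set \<Rightarrow> ('a \<times> 'a) set \<Rightarrow> ('a \<Rightarrow> real) \<Rightarrow> 'a \<Rightarrow> 'a" where
  "riem_grad M r f x = (THE \<xi>. \<xi> \<in> horizontal_space M r x \<and>
     (\<forall>\<eta>\<in>horizontal_space M r x. frechet_derivative f (at x within M) \<eta> = \<xi> \<bullet> \<eta>))"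

definition orth_proj :: "'a::euclidean_space set \<Rightarrow> 'a \<Rightarrow> 'a" where
  "orth_proj V v = (THE p. p \<in> V \<and> (\<forall>w\<in>V. (v - p) \<bullet> w = 0))"

text \<open>Clarke's generalized directional derivative and subdifferential of a function on a linear
  subspace \<open>V\<close>: the base point \<open>y \<rightarrow> \<eta>\<close> varies in \<open>V\<close> (with \<open>y = \<eta>\<close> allowed) and \<open>t \<rightarrow> 0+\<close>.\<close>

definition clarke_deriv ::
  "'a::euclidean_space set \<Rightarrow> ('a \<Rightarrow> real) \<Rightarrow> 'a \<Rightarrow> 'a \<Rightarrow> ereal" where
  "clarke_deriv V h \<eta> w =
     Limsup (inf (nhds \<eta>) (principal V) \<times>\<^sub>F at_right 0)
       (\<lambda>(y, t). ereal ((h (y + t *\<^sub>R w) - h y) / t))"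

definition clarke_subdifferential ::
  "'a::euclidean_space set \<Rightarrow> ('a \<Rightarrow> real) \<Rightarrow> 'a \<Rightarrow> 'a set" where
  "clarke_subdifferential V h \<eta> = {\<zeta>\<in>V. \<forall>w\<in>V. ereal (\<zeta> \<bullet> w) \<le> clarke_deriv V h \<eta> w}"

definition stationary_point :: "'a::euclidean_space set \<Rightarrow> ('a \<Rightarrow> real) \<Rightarrow> 'a \<Rightarrow> bool" where
  "stationary_point V h \<eta> \<longleftrightarrow> \<eta> \<in> V \<and> 0 \<in> clarke_subdifferential V h \<eta>"

section \<open>The Riemannian proximal mapping\<close>

definition sublevel_set :: "'a set \<Rightarrow> ('a \<Rightarrow> real) \<Rightarrow> 'a \<Rightarrow> 'a set" where
  "sublevel_set M F x\<^sub>0 = {x\<in>M. F x \<le> F x\<^sub>0}"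

definition prox_objective ::
  "'a::euclidean_space set \<Rightarrow> ('a \<times> 'a) set \<Rightarrow> ('a \<Rightarrow> 'a \<Rightarrow> 'a) \<Rightarrow> ('a \<Rightarrow> real) \<Rightarrow> ('a \<Rightarrow> real) \<Rightarrow>
   real \<Rightarrow> 'a \<Rightarrow> 'a \<Rightarrow> real" where
  "prox_objective M r R f g L x \<eta> =
     riem_grad M r f x \<bullet> \<eta> + L / 2 * (norm \<eta>)\<^sup>2 + g (R x \<eta>)"

definition prox :: "('a::euclidean_space \<Rightarrow> real) \<Rightarrow> real \<Rightarrow> 'a \<Rightarrow> 'a" where
  "prox g L z = (ARG_MIN (\<lambda>v. 1 / 2 * (norm (v - z))\<^sup>2 + 1 / L * g v) v. True)"

text \<open>\<open>\<real>\<^sup>k\<close> is represented by functions on \<open>{..<k}\<close> (values at other indices are ignored), with norm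
  \<^const>\<open>L2_set\<close>.\<close>

definition orthonormal_basis_of :: "'a::euclidean_space set \<Rightarrow> nat \<Rightarrow> (nat \<Rightarrow> 'a) \<Rightarrow> bool" where
  "orthonormal_basis_of V k b \<longleftrightarrow>
     (\<forall>i<k. \<forall>j<k. b i \<bullet> b j = (if i = j then 1 else 0)) \<and> span (b ` {..<k}) = V"

definition B_adj :: "nat \<Rightarrow> (nat \<Rightarrow> 'a::euclidean_space) \<Rightarrow> (nat \<Rightarrow> real) \<Rightarrow> 'a" where
  "B_adj k b \<Lambda> = (\<Sum>i<k. \<Lambda> i *\<^sub>R b i)"

definition v_dir ::
  "('a::euclidean_space \<Rightarrow> real) \<Rightarrow> real \<Rightarrow> 'a \<Rightarrow> nat \<Rightarrow> (nat \<Rightarrow> 'a) \<Rightarrow> 'a \<Rightarrow> (nat \<Rightarrow> real) \<Rightarrow> 'a" where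
  "v_dir g L G k b x \<Lambda> = prox g L (x - (1 / L) *\<^sub>R (G - B_adj k b \<Lambda>)) - x"

definition Psi ::
  "('a::euclidean_space \<Rightarrow> real) \<Rightarrow> real \<Rightarrow> 'a \<Rightarrow> nat \<Rightarrow> (nat \<Rightarrow> 'a) \<Rightarrow> 'a \<Rightarrow> (nat \<Rightarrow> real) \<Rightarrow> nat \<Rightarrow> real" where
  "Psi g L G k b x \<Lambda> i = b i \<bullet> v_dir g L G k b x \<Lambda>"

definition q_tilde :: "real \<Rightarrow> real \<Rightarrow> real \<Rightarrow> real \<Rightarrow> (real \<Rightarrow> real) \<Rightarrow> real \<Rightarrow> real" where
  "q_tilde L L\<^sub>g \<kappa>\<^sub>2 \<theta> \<phi> t =
     2 * L\<^sub>g * \<kappa>\<^sub>2 / (L - 2 * L\<^sub>g * \<kappa>\<^sub>2) * t +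
     sqrt ((4 * L * L\<^sub>g * \<kappa>\<^sub>2 - 4 * L\<^sub>g\<^sup>2 * \<kappa>\<^sub>2\<^sup>2) / (L - 2 * L\<^sub>g * \<kappa>\<^sub>2)\<^sup>2 * t\<^sup>2 +
           4 * \<theta> / (L - 2 * L\<^sub>g * \<kappa>\<^sub>2) * min (\<phi> t) (1 / 2))"

end

theory Submission
  imports Defs
begin

text \<open>Fix \<open>x\<close> and \<open>L\<close>, write \<open>G\<close> for the Riemannian gradient, \<open>V\<close> for the tangent (horizontal) space,
  \<open>\<eta>\<close> for the search direction, \<open>\<mu>\<close> for the norm of \<open>\<Psi>(\<Lambda>)\<close>, \<open>l\<close> for the Riemannian objective, and
  \<open>m(u) = G \<bullet> u + L/2 |u|\<^sup>2 + g (x + u)\<close> for its Euclidean model on \<open>V\<close>.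

  The optimality condition of the Euclidean proximal mapping is a variational inequality at the point
  \<open>x + v(\<Lambda>)\<close>. Tested with a tangent vector \<open>u - \<eta>\<close>, the multiplier \<open>B \<Lambda>\<close> drops out, and replacing
  \<open>v(\<Lambda>)\<close> by its projection \<open>\<eta>\<close> costs only \<open>2 L\<^sub>g \<mu>\<close>, because the normal part of \<open>v(\<Lambda>)\<close> has norm
  \<open>\<mu>\<close> (\<open>inexact_direction_variational\<close>). Hence \<open>\<eta>\<close> is almost a minimizer of the strongly convex model:
  \<open>m(u) \<ge> m(\<eta>) + L/2 |u - \<eta>|\<^sup>2 - 2 L\<^sub>g \<mu>\<close> on \<open>V\<close>.

  On the ball of radius \<open>\<rho>\<close> the two objectives differ by at most \<open>L\<^sub>g \<kappa>\<^sub>2 |u|\<^sup>2\<close>. Let \<open>\<eta>'\<close> minimize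
  \<open>l\<close> over the closed ball. For large \<open>L\<close> it lies in the interior, so that it is a local minimizer
  on \<open>V\<close> and therefore stationary (\<open>stationary_point_local_min\<close>), and \<open>\<eta>\<close> lies in the ball as well.
  From \<open>l(\<eta>') \<le> l(\<eta>)\<close> one obtains, with \<open>t = |\<eta>|\<close> and \<open>s = |\<eta> - \<eta>'|\<close>,
  \<open>L/2 s\<^sup>2 \<le> L\<^sub>g \<kappa>\<^sub>2 (t\<^sup>2 + (t + s)\<^sup>2) + 2 L\<^sub>g \<mu>\<close>, and solving this quadratic inequality for \<open>s\<close> yields
  \<open>q_tilde\<close> (\<open>q_tilde_bound\<close>). The threshold for \<open>L\<close> depends only on the constants, so it is uniform
  in \<open>x\<close> and \<open>\<Lambda>\<close>.

  Projections, normal vectors and minimization over \<open>V\<close> require \<open>V\<close> to be a linear space, whereas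
  tangent vectors are given as velocities of curves; slice charts provide the linearity
  (\<open>subspace_tangent_space\<close>).\<close>

section \<open>Tangent spaces are linear\<close>

lemma Ck_on_cong:
  assumes "open S" and "\<And>x. x \<in> S \<Longrightarrow> f x = g x" and "Ck_on k S f"
  shows "Ck_on k S g"
  using assms(2,3)
proof (induction k arbitrary: f g)
  case 0
  then show ?case
    by (simp cong: continuous_on_cong)
next
  case (Suc k)
  have D: "(g has_derivative frechet_derivative f (at x)) (at x)" if "x \<in> S" for x
  proof (rule has_derivative_transform_within_open[OF _ assms(1) that])
    show "(f has_derivative frechet_derivative f (at x)) (at x)"
      using Suc.prems(2) that by (simp add: frechet_derivative_works)
  qed (use Suc.prems(1) in auto)
  have "frechet_derivative f (at x) v = frechet_derivative g (at x) v" if "x \<in> S" for x v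
    using frechet_derivative_at[OF D[OF that]] by simp
  then have "Ck_on k S (\<lambda>x. frechet_derivative g (at x) v)" for v
    by (rule Suc.IH[of "\<lambda>x. frechet_derivative f (at x) v"]) (use Suc.prems(2) in auto)
  then show ?case
    using D by (auto simp: differentiable_def)
qed

lemma Ck_on_compose_line:
  fixes h :: "'a::euclidean_space \<Rightarrow> 'b::euclidean_space"
  assumes "open I" and "\<And>t. t \<in> I \<Longrightarrow> p + t *\<^sub>R w \<in> V" and "Ck_on k V h"
  shows "Ck_on k I (\<lambda>t::real. h (p + t *\<^sub>R w))"
  using assms(3)
proof (induction k arbitrary: h)
  case 0
  then have "continuous_on V h" by simp
  then show ?case
    unfolding Ck_on.simps
    by (rule continuous_on_compose2) (use assms(2) in \<open>auto intro!: continuous_intros\<close>)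
next
  case (Suc k)
  have D: "((\<lambda>t. h (p + t *\<^sub>R w)) has_derivative
      (\<lambda>s. frechet_derivative h (at (p + t *\<^sub>R w)) (s *\<^sub>R w))) (at t)" if "t \<in> I" for t
  proof -
    have "(h has_derivative frechet_derivative h (at (p + t *\<^sub>R w))) (at (p + t *\<^sub>R w))"
      using Suc.prems assms(2)[OF that] by (simp add: frechet_derivative_works)
    moreover have "((\<lambda>t. p + t *\<^sub>R w) has_derivative (\<lambda>s. s *\<^sub>R w)) (at t)"
      by (auto intro!: derivative_eq_intros)
    ultimately show ?thesis
      using has_derivative_compose by blast
  qed
  have eq: "frechet_derivative h (at (p + t *\<^sub>R w)) (s *\<^sub>R w)
      = frechet_derivative (\<lambda>t. h (p + t *\<^sub>R w)) (at t) s" if "t \<in> I" for t s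
    using frechet_derivative_at[OF D[OF that]] by metis
  have "Ck_on k I (\<lambda>t. frechet_derivative (\<lambda>t. h (p + t *\<^sub>R w)) (at t) s)" for s
  proof (rule Ck_on_cong[OF assms(1) eq])
    show "Ck_on k I (\<lambda>t. frechet_derivative h (at (p + t *\<^sub>R w)) (s *\<^sub>R w))"
      by (rule Suc.IH[of "\<lambda>y. frechet_derivative h (at y) (s *\<^sub>R w)"]) (use Suc.prems in simp)
  qed
  then show ?case
    using D by (auto simp: differentiable_def)
qed

lemma smooth_on_imp_has_derivative:
  assumes "smooth_on S f" and "x \<in> S"
  shows "(f has_derivative frechet_derivative f (at x)) (at x)"
proof -
  have "Ck_on (Suc 0) S f" using assms(1) unfolding smooth_on_def by blast
  then show ?thesis using assms(2) by (simp add: frechet_derivative_works)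
qed

text \<open>A subspace is the common kernel of the functionals given by its orthogonal complement, and
  each of these annihilates the curve near \<open>t\<close>.\<close>

lemma vector_derivative_in_subspace:
  fixes c :: "real \<Rightarrow> 'a::euclidean_space"
  assumes "subspace E" and "(c has_vector_derivative w) (at t)" and "\<forall>\<^sub>F s in nhds t. c s \<in> E"
  shows "w \<in> E"
proof -
  obtain S where S: "open S" "t \<in> S" "\<And>s. s \<in> S \<Longrightarrow> c s \<in> E"
    using assms(3) unfolding eventually_nhds by blast
  have "orthogonal n w" if n: "n \<in> E\<^sup>\<bottom>" for n
  proof -
    have "((\<lambda>s. c s \<bullet> n) has_vector_derivative w \<bullet> n) (at t)"
      using bounded_linear.has_vector_derivative[OF bounded_linear_inner_left assms(2)] .
    then have "((\<lambda>_. 0) has_vector_derivative w \<bullet> n) (at t)"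
      by (rule has_vector_derivative_transform_within_open[OF _ S(1,2)])
        (use S(3) n in \<open>auto simp: orthogonal_comp_def orthogonal_def\<close>)
    then show ?thesis
      using vector_derivative_unique_at[OF has_vector_derivative_const]
      by (auto simp: orthogonal_def inner_commute)
  qed
  then have "w \<in> E\<^sup>\<bottom>\<^sup>\<bottom>" by (simp add: orthogonal_comp_def[of "E\<^sup>\<bottom>"])
  then show ?thesis using orthogonal_comp_self[OF assms(1)] by simp
qed

text \<open>A slice chart straightens curves in \<open>M\<close> to curves in \<open>E\<close>, whose velocities lie in \<open>E\<close>, while
  straight lines in \<open>E\<close> are mapped back to curves in \<open>M\<close>. The tangent space is therefore the image of
  \<open>E\<close> under the derivative of the inverse chart.\<close>

lemma subspace_tangent_space:
  fixes M :: "'a::euclidean_space set"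
  assumes "embedded_submanifold M d" and "x \<in> M"
  shows "subspace (tangent_space M x)"
proof -
  obtain U V \<phi> \<psi> and E :: "'a set" where UV: "open U" "open V" "x \<in> U"
    and hom: "homeomorphism U V \<phi> \<psi>" and sm: "smooth_on U \<phi>" "smooth_on V \<psi>"
    and E: "subspace E" and slice: "\<phi> ` (M \<inter> U) = E \<inter> V"
    using assms unfolding embedded_submanifold_def by metis
  define D where "D = frechet_derivative \<psi> (at (\<phi> x))"
  have inv: "\<psi> (\<phi> y) = y" if "y \<in> U" for y
    using hom that by (simp add: homeomorphism_def)
  have \<phi>x: "\<phi> x \<in> E" "\<phi> x \<in> V" using slice assms(2) UV(3) by blast+
  have D: "(\<psi> has_derivative D) (at (\<phi> x))"
    unfolding D_def by (rule smooth_on_imp_has_derivative[OF sm(2) \<phi>x(2)])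
  have "tangent_space M x = D ` E"
  proof (intro equalityI subsetI)
    fix v assume "v \<in> tangent_space M x"
    then obtain c :: "real \<Rightarrow> 'a" and e where e: "e > 0" and c: "c ` {-e<..<e} \<subseteq> M" "c 0 = x"
      and cv: "(c has_vector_derivative v) (at 0)"
      unfolding tangent_space_def by auto
    have "(c \<longlongrightarrow> x) (nhds 0)"
      using has_vector_derivative_continuous[OF cv] c(2)
      by (metis continuous_at tendsto_at_iff_tendsto_nhds)
    then have "\<forall>\<^sub>F t in nhds 0. c t \<in> U"
      using UV(1,3) by (rule topological_tendstoD)
    moreover have "\<forall>\<^sub>F t in nhds (0::real). t \<in> {-e<..<e}"
      using e by (intro eventually_nhds_in_open) auto
    ultimately have near: "\<forall>\<^sub>F t in nhds 0. c t \<in> M \<inter> U"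
      by eventually_elim (use c(1) in auto)
    define w where "w = frechet_derivative \<phi> (at x) v"
    have \<phi>c: "((\<lambda>t. \<phi> (c t)) has_vector_derivative w) (at 0)"
      using vector_derivative_diff_chain_within[OF cv, of \<phi> "frechet_derivative \<phi> (at x)"]
        smooth_on_imp_has_derivative[OF sm(1) UV(3)] c(2)
      by (auto simp: w_def o_def intro: has_derivative_at_withinI)
    have "w \<in> E"
      using near slice by (intro vector_derivative_in_subspace[OF E \<phi>c]) (auto elim!: eventually_mono)
    moreover have "D w = v"
    proof -
      have "((\<lambda>t. \<psi> (\<phi> (c t))) has_vector_derivative D w) (at 0)"
        using vector_derivative_diff_chain_within[OF \<phi>c, of \<psi> D] D c(2)
        by (auto simp: o_def intro: has_derivative_at_withinI)
      moreover obtain S where S: "open S" "0 \<in> S" "\<forall>t\<in>S. c t \<in> M \<inter> U"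
        using near unfolding eventually_nhds by blast
      moreover have "\<psi> (\<phi> (c t)) = c t" if "t \<in> S" for t
        using inv S(3) that by blast
      ultimately have "(c has_vector_derivative D w) (at 0)"
        using has_vector_derivative_transform_within_open by blast
      then show ?thesis using cv vector_derivative_unique_at by blast
    qed
    ultimately show "v \<in> D ` E" by blast
  next
    fix v assume "v \<in> D ` E"
    then obtain w where w: "w \<in> E" and v: "v = D w" by blast
    have "((\<lambda>t. \<phi> x + t *\<^sub>R w) \<longlongrightarrow> \<phi> x + 0 *\<^sub>R w) (nhds (0::real))"
      by (intro tendsto_intros) (simp add: filterlim_ident)
    then have "\<forall>\<^sub>F t in nhds 0. \<phi> x + t *\<^sub>R w \<in> V"
      using UV(2) \<phi>x(2) by (intro topological_tendstoD) auto
    then obtain e where e: "e > 0" "\<And>t. \<bar>t\<bar> < e \<Longrightarrow> \<phi> x + t *\<^sub>R w \<in> V"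
      unfolding eventually_nhds_metric by (auto simp: dist_real_def)
    define c where "c = (\<lambda>t. \<psi> (\<phi> x + t *\<^sub>R w))"
    have "smooth_on {-e<..<e} c"
      unfolding smooth_on_def c_def
    proof
      show "Ck_on k {-e<..<e} (\<lambda>t. \<psi> (\<phi> x + t *\<^sub>R w))" for k
        by (rule Ck_on_compose_line[where V = V]) (use sm(2) e(2) in \<open>auto simp: smooth_on_def\<close>)
    qed
    moreover have "c t \<in> M" if "t \<in> {-e<..<e}" for t
    proof -
      have "\<phi> x + t *\<^sub>R w \<in> E \<inter> V"
        using e(2)[of t] that w \<phi>x(1) E by (auto intro: subspace_add subspace_scale)
      then obtain m where "m \<in> M \<inter> U" "\<phi> x + t *\<^sub>R w = \<phi> m" using slice by blast
      then show ?thesis using inv by (auto simp: c_def)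
    qed
    moreover have "c 0 = x" using inv UV(3) by (simp add: c_def)
    moreover have "(c has_vector_derivative v) (at 0)"
    proof -
      have "((\<lambda>t. \<phi> x + t *\<^sub>R w) has_vector_derivative w) (at 0)"
        by (auto intro!: derivative_eq_intros)
      from vector_derivative_diff_chain_within[OF this, of \<psi> D] D show ?thesis
        by (auto simp: o_def c_def v intro: has_derivative_at_withinI)
    qed
    ultimately show "v \<in> tangent_space M x"
      unfolding tangent_space_def using e(1)
      by (intro CollectI exI[of _ c] exI[of _ e] conjI image_subsetI)
  qed
  then show ?thesis
    using E has_derivative_linear[OF D] by (simp add: linear_subspace_image)
qed

lemma subspace_horizontal_space:
  assumes "(embedded_submanifold M d \<and> r = Id_on M) \<or> riemannian_quotient M r d" and "x \<in> M"
  shows "subspace (horizontal_space M r x)"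
proof -
  obtain D where "embedded_submanifold M D"
    using assms(1) unfolding riemannian_quotient_def quotient_manifold_def by blast
  then show ?thesis
    unfolding horizontal_space_def
    using assms(2) by (intro subspace_inter subspace_tangent_space subspace_orthogonal_comp)
qed

section \<open>Continuity of smooth maps and stationarity of local minimizers\<close>

lemma smooth_map_on_imp_continuous_on:
  assumes "smooth_map_on A f"
  shows "continuous_on A f"
proof (rule continuous_on_eq_continuous_within[THEN iffD2], rule ballI)
  fix p assume p: "p \<in> A"
  then obtain U h where U: "open U" "p \<in> U" and h: "smooth_on U h" "\<forall>q\<in>A \<inter> U. h q = f q"
    using assms unfolding smooth_map_on_def by blast
  have "Ck_on 0 U h" using h(1) unfolding smooth_on_def by blast
  then have "continuous (at p within A) h"
    using U by (simp add: continuous_on_eq_continuous_at continuous_at_imp_continuous_within)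
  then show "continuous (at p within A) f"
  proof (rule continuous_transform_within_openin[OF _ _ _ h(2)[rule_format]])
    show "openin (top_of_set A) (A \<inter> U)" using U(1) by blast
  qed (use U p in auto)
qed

text \<open>The base point of Clarke's difference quotients may be kept at \<open>\<eta>\<close>, where they are nonnegative
  for small steps.\<close>

lemma stationary_point_local_min:
  fixes h :: "'a::euclidean_space \<Rightarrow> real"
  assumes V: "subspace V" and "\<eta> \<in> V" and "e > 0"
    and min: "\<And>u. u \<in> V \<Longrightarrow> norm (u - \<eta>) < e \<Longrightarrow> h \<eta> \<le> h u"
  shows "stationary_point V h \<eta>"
proof -
  have "0 \<le> clarke_deriv V h \<eta> w" if w: "w \<in> V" for w
  proof (rule ccontr)
    assume "\<not> 0 \<le> clarke_deriv V h \<eta> w"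
    then have "\<forall>\<^sub>F z in inf (nhds \<eta>) (principal V) \<times>\<^sub>F at_right 0.
        (case z of (y, t) \<Rightarrow> ereal ((h (y + t *\<^sub>R w) - h y) / t)) < 0"
      unfolding clarke_deriv_def by (intro Limsup_lessD) auto
    then obtain P Q where P: "\<forall>\<^sub>F y in inf (nhds \<eta>) (principal V). P y"
      and Q: "\<forall>\<^sub>F t in at_right 0. Q t"
      and PQ: "\<And>y t. P y \<Longrightarrow> Q t \<Longrightarrow> (h (y + t *\<^sub>R w) - h y) / t < 0"
      unfolding eventually_prod_filter by auto
    have "P \<eta>"
      using P \<open>\<eta> \<in> V\<close> eventually_nhds_x_imp_x unfolding eventually_inf_principal by fastforce
    have "\<forall>\<^sub>F t in at_right (0::real). 0 < t \<and> t < e / (norm w + 1)"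
      using \<open>e > 0\<close> by (auto simp: eventually_at_right_field intro!: exI[of _ "e / (norm w + 1)"]
        divide_pos_pos add_nonneg_pos)
    then have "\<forall>\<^sub>F t in at_right (0::real). (0 < t \<and> t < e / (norm w + 1)) \<and> Q t"
      using Q by (rule eventually_conj)
    then obtain t where t: "0 < t" "t < e / (norm w + 1)" "Q t"
      using eventually_happens'[of "at_right (0::real)"] by force
    have "t * (norm w + 1) < e"
      using t(2) by (simp add: pos_less_divide_eq add_nonneg_pos)
    then have "norm ((\<eta> + t *\<^sub>R w) - \<eta>) < e"
      using t(1) by (simp add: algebra_simps)
    then have "h \<eta> \<le> h (\<eta> + t *\<^sub>R w)"
      using V w \<open>\<eta> \<in> V\<close> by (intro min) (auto intro: subspace_add subspace_scale)
    then show False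
      using PQ[OF \<open>P \<eta>\<close> \<open>Q t\<close>] t(1) by (simp add: divide_less_0_iff)
  qed
  then show ?thesis
    using V \<open>\<eta> \<in> V\<close>
    by (auto simp: stationary_point_def clarke_subdifferential_def zero_ereal_def subspace_0)
qed

section \<open>The Euclidean proximal mapping\<close>

lemma lipschitz_real_le:
  fixes g :: "'a::real_normed_vector \<Rightarrow> real"
  assumes "K-lipschitz_on UNIV g"
  shows "g u - g v \<le> K * norm (u - v)"
  using lipschitz_onD[OF assms, of u v] by (simp add: dist_norm dist_real_def)

text \<open>The quadratic term outgrows the at most linear decrease of \<open>g\<close>, so that a minimizer over a
  large ball is a global one.\<close>

lemma prox_minimizes:
  fixes g :: "'a::euclidean_space \<Rightarrow> real"
  assumes g: "K-lipschitz_on UNIV g" and L: "L > 0"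
  shows "1 / 2 * (norm (prox g L z - z))\<^sup>2 + 1 / L * g (prox g L z)
    \<le> 1 / 2 * (norm (v - z))\<^sup>2 + 1 / L * g v"
proof -
  define h where "h = (\<lambda>v. 1 / 2 * (norm (v - z))\<^sup>2 + 1 / L * g v)"
  define s where "s = 2 * K / L"
  have K: "K \<ge> 0" using g by (rule lipschitz_on_nonneg)
  have "continuous_on (cball z s) h"
    unfolding h_def
    by (intro continuous_intros continuous_on_subset[OF lipschitz_on_continuous_on[OF g]]) auto
  moreover have "z \<in> cball z s" using K L by (simp add: s_def)
  ultimately obtain p where p: "\<And>u. u \<in> cball z s \<Longrightarrow> h p \<le> h u"
    using continuous_attains_inf[OF compact_cball] by (metis empty_iff)
  have "h p \<le> h u" for u
  proof (cases "u \<in> cball z s")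
    case False
    then have "norm (u - z) > s" by (simp add: dist_norm norm_minus_commute)
    then have "norm (u - z) * s \<le> norm (u - z) * norm (u - z)" by (intro mult_left_mono) auto
    then have "K / L * norm (u - z) \<le> 1 / 2 * (norm (u - z))\<^sup>2"
      by (simp add: s_def power2_eq_square ac_simps)
    moreover have "1 / L * (g z - g u) \<le> 1 / L * (K * norm (u - z))"
      using lipschitz_real_le[OF g, of z u] L
      by (intro mult_left_mono) (auto simp: norm_minus_commute)
    then have "1 / L * g z - 1 / L * g u \<le> K / L * norm (u - z)"
      by (simp add: diff_divide_distrib)
    moreover have "h z = 1 / L * g z" by (simp add: h_def)
    moreover have "h u = 1 / 2 * (norm (u - z))\<^sup>2 + 1 / L * g u" by (simp add: h_def)
    ultimately have "h z \<le> h u" by linarith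
    then show ?thesis using p[OF \<open>z \<in> cball z s\<close>] by linarith
  qed (rule p)
  then have "is_arg_min h (\<lambda>_. True) p"
    by (simp add: is_arg_min_linorder)
  then have "is_arg_min h (\<lambda>_. True) (prox g L z)"
    unfolding prox_def h_def[symmetric] arg_min_def by (rule someI)
  then show ?thesis by (simp add: is_arg_min_linorder h_def)
qed

text \<open>Comparing \<open>p = Prox(z)\<close> with \<open>p + t w\<close>, convexity bounds the change of \<open>g\<close> by
  \<open>t (g (p + w) - g p)\<close>; dividing by \<open>t\<close> and letting \<open>t \<rightarrow> 0\<close> removes the quadratic term.\<close>

lemma prox_variational:
  fixes g :: "'a::euclidean_space \<Rightarrow> real"
  assumes g: "K-lipschitz_on UNIV g" "convex_on UNIV g" and L: "L > 0"
  shows "0 \<le> L * ((prox g L z - z) \<bullet> w) + g (prox g L z + w) - g (prox g L z)"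
proof -
  define p where "p = prox g L z"
  let ?a = "L * ((p - z) \<bullet> w) + g (p + w) - g p"
  have "0 \<le> ?a + t * (L / 2 * (norm w)\<^sup>2)" if t: "0 < t" "t < 1" for t
  proof -
    have "1 / 2 * (norm (p - z))\<^sup>2 + 1 / L * g p
        \<le> 1 / 2 * (norm (p + t *\<^sub>R w - z))\<^sup>2 + 1 / L * g (p + t *\<^sub>R w)"
      unfolding p_def by (rule prox_minimizes[OF g(1) L])
    then have "L * (1 / 2 * (norm (p - z))\<^sup>2 + 1 / L * g p)
        \<le> L * (1 / 2 * (norm (p + t *\<^sub>R w - z))\<^sup>2 + 1 / L * g (p + t *\<^sub>R w))"
      using L by (intro mult_left_mono) auto
    then have "L / 2 * (norm (p - z))\<^sup>2 + g p
        \<le> L / 2 * (norm ((p - z) + t *\<^sub>R w))\<^sup>2 + g (p + t *\<^sub>R w)"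
      using L by (simp add: algebra_simps)
    moreover have "(norm ((p - z) + t *\<^sub>R w))\<^sup>2
        = (norm (p - z))\<^sup>2 + 2 * (t * ((p - z) \<bullet> w)) + t * (t * (norm w)\<^sup>2)"
      by (simp add: power2_norm_eq_inner inner_add inner_commute[of w "p - z"] distrib_left)
    then have "L / 2 * (norm ((p - z) + t *\<^sub>R w))\<^sup>2 = L / 2 * (norm (p - z))\<^sup>2
        + t * (L * ((p - z) \<bullet> w)) + t * (t * (L / 2 * (norm w)\<^sup>2))"
      by (simp add: distrib_left mult.left_commute)
    moreover have "g (p + t *\<^sub>R w) \<le> g p + t * g (p + w) - t * g p"
      using convex_onD[OF g(2), of t p "p + w"] t by (simp add: algebra_simps)
    ultimately have "0 \<le> t * (L * ((p - z) \<bullet> w)) + t * (t * (L / 2 * (norm w)\<^sup>2))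
        + t * g (p + w) - t * g p"
      by linarith
    then have "0 \<le> t * (?a + t * (L / 2 * (norm w)\<^sup>2))"
      by (simp add: distrib_left right_diff_distrib)
    then show ?thesis using t(1) by (simp add: zero_le_mult_iff)
  qed
  then have "\<forall>\<^sub>F t in at_right 0. 0 \<le> ?a + t * (L / 2 * (norm w)\<^sup>2)"
    by (auto simp: eventually_at_right_field intro!: exI[of _ 1])
  moreover have "((\<lambda>t. ?a + t * (L / 2 * (norm w)\<^sup>2)) \<longlongrightarrow> ?a + 0 * (L / 2 * (norm w)\<^sup>2)) (at_right 0)"
    by (intro tendsto_intros)
  ultimately have "0 \<le> ?a + 0 * (L / 2 * (norm w)\<^sup>2)"
    by (intro tendsto_lowerbound) auto
  then show ?thesis by (simp add: p_def)
qed

section \<open>The inexact search direction\<close>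

lemma orth_proj_eqI:
  assumes V: "subspace V" and p: "p \<in> V" and n: "v - p \<in> V\<^sup>\<bottom>"
  shows "orth_proj V v = p"
  unfolding orth_proj_def
proof (rule the_equality)
  have orth: "(v - p) \<bullet> w = 0" if "w \<in> V" for w
    using n that by (auto simp: orthogonal_comp_def orthogonal_def inner_commute)
  then show "p \<in> V \<and> (\<forall>w\<in>V. (v - p) \<bullet> w = 0)" using p by blast
  fix q assume q: "q \<in> V \<and> (\<forall>w\<in>V. (v - q) \<bullet> w = 0)"
  then have "q - p \<in> V" using V p by (blast intro: subspace_diff)
  then have "(v - p) \<bullet> (q - p) - (v - q) \<bullet> (q - p) = 0" using orth q by simp
  then have "(q - p) \<bullet> (q - p) = 0" by (simp add: inner_diff_left[symmetric])
  then show "q = p" by simp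
qed

lemma B_adj_in_span: "B_adj k b \<Lambda> \<in> span (b ` {..<k})"
  unfolding B_adj_def by (intro span_sum span_scale span_base) auto

lemma orth_proj_orthonormal_normal_basis:
  fixes V :: "'a::euclidean_space set"
  assumes V: "subspace V" and b: "orthonormal_basis_of (V\<^sup>\<bottom>) k b"
  shows "orth_proj V v \<in> V"
    and "v - orth_proj V v \<in> V\<^sup>\<bottom>"
    and "norm (v - orth_proj V v) = L2_set (\<lambda>i. b i \<bullet> v) {..<k}"
proof -
  define n where "n = B_adj k b (\<lambda>i. b i \<bullet> v)"
  have orth: "b i \<bullet> b j = (if i = j then 1 else 0)" if "i < k" "j < k" for i j
    using b that by (simp add: orthonormal_basis_of_def)
  have span: "span (b ` {..<k}) = V\<^sup>\<bottom>" using b by (simp add: orthonormal_basis_of_def)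
  have bn: "b i \<bullet> n = b i \<bullet> v" if "i < k" for i
  proof -
    have "b i \<bullet> n = (\<Sum>j<k. (b j \<bullet> v) * (if j = i then 1 else 0))"
      unfolding n_def B_adj_def inner_sum_right using orth that by (intro sum.cong) auto
    also have "\<dots> = (\<Sum>j<k. if j = i then b j \<bullet> v else 0)"
      by (intro sum.cong) auto
    finally show ?thesis using that by simp
  qed
  have n: "n \<in> V\<^sup>\<bottom>" unfolding n_def span[symmetric] by (rule B_adj_in_span)
  have "orthogonal (v - n) y" if "y \<in> span (b ` {..<k})" for y
    using that
    by (rule orthogonal_to_span)
      (auto simp: orthogonal_def inner_commute[of "v - n"] inner_diff_right bn)
  then have "v - n \<in> V\<^sup>\<bottom>\<^sup>\<bottom>"
    by (auto simp: span orthogonal_comp_def[of "V\<^sup>\<bottom>"] orthogonal_commute)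
  then have "v - n \<in> V" using orthogonal_comp_self[OF V] by simp
  then have P: "orth_proj V v = v - n"
    using V n by (intro orth_proj_eqI) auto
  show "orth_proj V v \<in> V" "v - orth_proj V v \<in> V\<^sup>\<bottom>"
    using P \<open>v - n \<in> V\<close> n by auto
  have "n \<bullet> n = (\<Sum>i<k. (b i \<bullet> v) * (b i \<bullet> n))"
    by (subst (1) n_def) (simp add: B_adj_def inner_sum_left)
  also have "\<dots> = (\<Sum>i<k. (b i \<bullet> v)\<^sup>2)"
    by (intro sum.cong) (auto simp: bn power2_eq_square)
  finally show "norm (v - orth_proj V v) = L2_set (\<lambda>i. b i \<bullet> v) {..<k}"
    by (simp add: P L2_set_def norm_eq_sqrt_inner)
qed

text \<open>The test direction \<open>u - \<eta>\<close> in the variational inequality is tangent, hence orthogonal to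
  the multiplier term \<open>B \<Lambda>\<close> and to the normal part of \<open>v(\<Lambda>)\<close>. The inexactness is thus seen
  only by \<open>g\<close>, at two points that are shifted by the normal part.\<close>

lemma inexact_direction_variational:
  fixes g :: "'a::euclidean_space \<Rightarrow> real"
  assumes g: "K-lipschitz_on UNIV g" "convex_on UNIV g" and L: "L > 0"
    and V: "subspace V" and b: "orthonormal_basis_of (V\<^sup>\<bottom>) k b"
    and \<eta>: "\<eta> = orth_proj V (v_dir g L G k b x \<Lambda>)" and u: "u \<in> V"
  shows "- 2 * K * L2_set (Psi g L G k b x \<Lambda>) {..<k}
    \<le> (G + L *\<^sub>R \<eta>) \<bullet> (u - \<eta>) + g (x + u) - g (x + \<eta>)"
proof -
  define v where "v = v_dir g L G k b x \<Lambda>"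
  define z where "z = x - (1 / L) *\<^sub>R (G - B_adj k b \<Lambda>)"
  have p: "prox g L z = x + v" by (simp add: v_def v_dir_def z_def)
  have "Psi g L G k b x \<Lambda> = (\<lambda>i. b i \<bullet> v)" by (simp add: fun_eq_iff Psi_def v_def)
  then have \<eta>V: "\<eta> \<in> V" and n: "v - \<eta> \<in> V\<^sup>\<bottom>"
    and norm_n: "norm (v - \<eta>) = L2_set (Psi g L G k b x \<Lambda>) {..<k}"
    using orth_proj_orthonormal_normal_basis[OF V b, of v] by (simp_all add: \<eta> v_def[symmetric])
  have w: "u - \<eta> \<in> V" using V u \<eta>V by (rule subspace_diff)
  have "B_adj k b \<Lambda> \<in> V\<^sup>\<bottom>"
    using B_adj_in_span b unfolding orthonormal_basis_of_def by metis
  then have orth: "B_adj k b \<Lambda> \<bullet> (u - \<eta>) = 0" "(v - \<eta>) \<bullet> (u - \<eta>) = 0"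
    using n w by (auto simp: orthogonal_comp_def orthogonal_def inner_commute)
  have "L *\<^sub>R (x + v - z) = G + L *\<^sub>R \<eta> + (L *\<^sub>R (v - \<eta>) - B_adj k b \<Lambda>)"
    using L by (simp add: z_def algebra_simps)
  then have "L *\<^sub>R (x + v - z) \<bullet> (u - \<eta>)
      = (G + L *\<^sub>R \<eta>) \<bullet> (u - \<eta>) + (L * ((v - \<eta>) \<bullet> (u - \<eta>)) - B_adj k b \<Lambda> \<bullet> (u - \<eta>))"
    by (simp only: inner_add_left inner_diff_left[of "L *\<^sub>R _"] inner_scaleR_left)
  then have "L * ((x + v - z) \<bullet> (u - \<eta>)) = (G + L *\<^sub>R \<eta>) \<bullet> (u - \<eta>)"
    by (simp only: orth inner_scaleR_left)
  then have "0 \<le> (G + L *\<^sub>R \<eta>) \<bullet> (u - \<eta>) + g (x + v + (u - \<eta>)) - g (x + v)"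
    using prox_variational[OF g L, of z "u - \<eta>"] by (simp add: p)
  moreover have "g (x + v + (u - \<eta>)) - g (x + u) \<le> K * norm (v - \<eta>)"
    using lipschitz_real_le[OF g(1), of "x + v + (u - \<eta>)" "x + u"] by (simp add: algebra_simps)
  moreover have "g (x + \<eta>) - g (x + v) \<le> K * norm (v - \<eta>)"
    using lipschitz_real_le[OF g(1), of "x + \<eta>" "x + v"] by (simp add: norm_minus_commute)
  ultimately show ?thesis by (simp add: norm_n)
qed

section \<open>Comparison with the Riemannian proximal mapping\<close>

lemma quadratic_root_bound:
  fixes A B C s :: real
  assumes A: "A > 0" and quad: "A * s\<^sup>2 - 2 * B * s \<le> C"
  shows "s \<le> B / A + sqrt ((B\<^sup>2 + A * C) / A\<^sup>2)"
proof -
  have "A * (A * s\<^sup>2 - 2 * B * s) \<le> A * C" using A quad by (intro mult_left_mono) auto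
  then have "(A * s - B)\<^sup>2 \<le> B\<^sup>2 + A * C" by (simp add: power2_eq_square algebra_simps)
  then have "A * s - B \<le> sqrt (B\<^sup>2 + A * C)" by (rule real_le_rsqrt)
  then have "s \<le> (B + sqrt (B\<^sup>2 + A * C)) / A" using A by (simp add: field_simps)
  moreover have "sqrt ((B\<^sup>2 + A * C) / A\<^sup>2) = sqrt (B\<^sup>2 + A * C) / A"
    using A unfolding real_sqrt_divide by simp
  ultimately show ?thesis by (simp add: add_divide_distrib)
qed

text \<open>Read \<open>t\<close> as the length of the search direction, \<open>s\<close> as its distance to the stationary
  point and \<open>\<mu>\<close> as the norm of \<open>\<Psi>\<close>: then \<open>q_tilde\<close> is the larger root of the quadratic
  inequality, once the error \<open>2 L\<^sub>g \<mu>\<close> is coarsened to \<open>2 \<theta> min (\<phi> t) 0.5\<close>.\<close>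

lemma q_tilde_bound:
  fixes L K \<kappa> s t \<mu> \<theta> :: real
  assumes A: "L > 2 * K * \<kappa>"
    and quad: "L / 2 * s\<^sup>2 \<le> K * \<kappa> * (t\<^sup>2 + (t + s)\<^sup>2) + 2 * K * \<mu>"
    and \<mu>: "0 \<le> \<mu>" "\<mu> \<le> min (\<phi> t) (1 / 2)" and \<theta>: "0 \<le> K" "K \<le> \<theta>"
  shows "s \<le> q_tilde L K \<kappa> \<theta> \<phi> t"
proof -
  define A m where "A = L - 2 * K * \<kappa>" and "m = min (\<phi> t) (1 / 2)"
  have A0: "A > 0" using A by (simp add: A_def)
  have "K * \<mu> \<le> \<theta> * m" using \<mu> \<theta> unfolding m_def by (intro mult_mono) auto
  then have "A * s\<^sup>2 - 2 * (2 * K * \<kappa> * t) * s \<le> 4 * K * \<kappa> * t\<^sup>2 + 4 * (\<theta> * m)"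
    using quad by (simp add: A_def power2_eq_square algebra_simps)
  from quadratic_root_bound[OF A0 this]
  have "s \<le> 2 * K * \<kappa> * t / A
      + sqrt (((2 * K * \<kappa> * t)\<^sup>2 + A * (4 * K * \<kappa> * t\<^sup>2 + 4 * (\<theta> * m))) / A\<^sup>2)" .
  moreover have "((2 * K * \<kappa> * t)\<^sup>2 + A * (4 * K * \<kappa> * t\<^sup>2 + 4 * (\<theta> * m))) / A\<^sup>2
      = (4 * L * K * \<kappa> - 4 * K\<^sup>2 * \<kappa>\<^sup>2) / A\<^sup>2 * t\<^sup>2 + 4 * \<theta> / A * m"
  proof -
    have eq: "(2 * K * \<kappa> * t)\<^sup>2 + A * (4 * K * \<kappa> * t\<^sup>2 + 4 * (\<theta> * m))
        = (4 * L * K * \<kappa> - 4 * K\<^sup>2 * \<kappa>\<^sup>2) * t\<^sup>2 + A * (4 * \<theta> * m)"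
      by (simp add: A_def power2_eq_square algebra_simps)
    have "A * (4 * \<theta> * m) / A\<^sup>2 = 4 * \<theta> / A * m"
      using A0 by (simp add: power2_eq_square)
    then show ?thesis
      unfolding eq add_divide_distrib by simp
  qed
  ultimately show ?thesis
    by (simp add: q_tilde_def A_def[symmetric] m_def[symmetric])
qed

text \<open>The comparison at one base point. Here \<open>S\<close> stands for the retraction and \<open>\<eta>\<close> for an inexact
  minimizer of the Euclidean model \<open>G \<bullet> u + L/2 |u|\<^sup>2 + g (x + u)\<close> on \<open>V\<close>. The summand
  \<open>2 K |\<kappa>|\<close> of the bound on \<open>L\<close> lets the quadratic term absorb the retraction error, the next one
  then keeps the minimizer of the retracted model over the ball off the boundary sphere, and the
  last one helps to bring \<open>\<eta>\<close> into the ball.\<close>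

lemma stationary_point_near_inexact_minimizer:
  fixes g :: "'a::euclidean_space \<Rightarrow> real"
  assumes g: "K-lipschitz_on UNIV g" and V: "subspace V"
    and S: "continuous_on V S" "S 0 = x" and \<rho>: "\<rho> > 0"
    and \<kappa>: "\<And>u. u \<in> V \<Longrightarrow> norm u \<le> \<rho> \<Longrightarrow> norm (S u - x - u) \<le> \<kappa> * (norm u)\<^sup>2"
    and G: "norm G \<le> U"
    and L: "L > 2 * K * \<bar>\<kappa>\<bar> + 2 * (U + K) / \<rho> + K / \<rho>\<^sup>2"
    and \<eta>: "\<eta> \<in> V"
    and inexact: "\<And>u. u \<in> V \<Longrightarrow>
      - 2 * K * \<mu> \<le> (G + L *\<^sub>R \<eta>) \<bullet> (u - \<eta>) + g (x + u) - g (x + \<eta>)"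
    and \<mu>: "0 \<le> \<mu>" "\<mu> \<le> min (\<phi> (norm \<eta>)) (1 / 2)"
    and \<phi>0: "\<phi> 0 = 0" and \<theta>: "K \<le> \<theta>"
  shows "\<exists>\<eta>'. stationary_point V (\<lambda>u. G \<bullet> u + L / 2 * (norm u)\<^sup>2 + g (S u)) \<eta>' \<and>
    norm (\<eta> - \<eta>') \<le> q_tilde L K \<kappa> \<theta> \<phi> (norm \<eta>)"
proof -
  define l where "l = (\<lambda>u. G \<bullet> u + L / 2 * (norm u)\<^sup>2 + g (S u))"
  have K: "K \<ge> 0" using g by (rule lipschitz_on_nonneg)
  have U: "U \<ge> 0" using G norm_ge_zero order_trans by blast
  have quot: "K / \<rho>\<^sup>2 \<ge> 0" "2 * (U + K) / \<rho> \<ge> 0" "K * \<bar>\<kappa>\<bar> \<ge> 0" using K U \<rho> by auto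
  have "K * \<kappa> \<le> K * \<bar>\<kappa>\<bar>" using K by (intro mult_left_mono) auto
  then have L\<kappa>: "L > 2 * K * \<kappa> + 2 * (U + K) / \<rho>" "L > 2 * K * \<kappa>" and L0: "L > 0"
    using L quot by linarith+
  have Gu: "\<bar>G \<bullet> u\<bar> \<le> U * norm u" for u
    using Cauchy_Schwarz_ineq2[of G u] G by (meson mult_right_mono norm_ge_zero order_trans)
  have gS: "\<bar>g (S u) - g (x + u)\<bar> \<le> K * \<kappa> * (norm u)\<^sup>2" if "u \<in> V" "norm u \<le> \<rho>" for u
  proof -
    have "\<bar>g (S u) - g (x + u)\<bar> \<le> K * norm (S u - x - u)"
      using lipschitz_onD[OF g, of "S u" "x + u"] by (simp add: dist_norm algebra_simps)
    also have "\<dots> \<le> K * (\<kappa> * (norm u)\<^sup>2)" using K \<kappa>[OF that] by (intro mult_left_mono)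
    finally show ?thesis by simp
  qed

  \<comment> \<open>with \<open>u = 0\<close>, the inexactness inequality gives \<open>L |\<eta>|\<^sup>2 \<le> (U + K) |\<eta>| + K\<close>\<close>
  have \<eta>\<rho>: "norm \<eta> \<le> \<rho>"
  proof (rule ccontr)
    assume "\<not> norm \<eta> \<le> \<rho>"
    then have t: "\<rho> < norm \<eta>" by simp
    have "2 * K * \<mu> \<le> K" using mult_left_mono[of \<mu> "1/2" "2 * K"] \<mu> K by simp
    moreover have "g x - g (x + \<eta>) \<le> K * norm \<eta>"
      using lipschitz_real_le[OF g, of x "x + \<eta>"] by simp
    moreover have "(G + L *\<^sub>R \<eta>) \<bullet> (0 - \<eta>) = - (G \<bullet> \<eta>) - L * (norm \<eta>)\<^sup>2"
      by (simp add: power2_norm_eq_inner inner_add_left)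
    ultimately have "L * (norm \<eta>)\<^sup>2 \<le> (U + K) * norm \<eta> + K"
      using inexact[OF subspace_0[OF V]] Gu[of \<eta>] by (simp add: distrib_right)
    also have "\<dots> \<le> (U + K) / \<rho> * (norm \<eta>)\<^sup>2 + K / \<rho>\<^sup>2 * (norm \<eta>)\<^sup>2"
    proof (intro add_mono)
      have "(U + K) * norm \<eta> * \<rho> \<le> (U + K) * norm \<eta> * norm \<eta>"
        using t K U by (intro mult_left_mono) auto
      then show "(U + K) * norm \<eta> \<le> (U + K) / \<rho> * (norm \<eta>)\<^sup>2"
        using \<rho> by (simp add: field_simps power2_eq_square)
      have "K * \<rho>\<^sup>2 \<le> K * (norm \<eta>)\<^sup>2"
        using t K \<rho> by (intro mult_left_mono power_mono) auto
      then show "K \<le> K / \<rho>\<^sup>2 * (norm \<eta>)\<^sup>2" using \<rho> by (simp add: field_simps)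
    qed
    finally have "L * (norm \<eta>)\<^sup>2 \<le> ((U + K) / \<rho> + K / \<rho>\<^sup>2) * (norm \<eta>)\<^sup>2"
      by (simp add: distrib_right)
    moreover have "(norm \<eta>)\<^sup>2 > 0" using t \<rho> by auto
    ultimately have "L \<le> (U + K) / \<rho> + K / \<rho>\<^sup>2" by simp
    then show False using L quot by (simp only: times_divide_eq_right[symmetric])
  qed

  obtain \<eta>' where \<eta>': "\<eta>' \<in> V" "norm \<eta>' \<le> \<rho>"
    and min: "\<And>u. u \<in> V \<Longrightarrow> norm u \<le> \<rho> \<Longrightarrow> l \<eta>' \<le> l u"
  proof -
    have "compact (V \<inter> cball 0 \<rho>)"
      using closed_subspace[OF V] by (intro closed_Int_compact) auto
    moreover have "0 \<in> V \<inter> cball 0 \<rho>" using subspace_0[OF V] \<rho> by simp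
    moreover have "continuous_on (V \<inter> cball 0 \<rho>) l"
      unfolding l_def
      by (intro continuous_intros continuous_on_compose2[OF lipschitz_on_continuous_on[OF g]]
          continuous_on_subset[OF S(1)]) auto
    ultimately show thesis
      using continuous_attains_inf[of "V \<inter> cball 0 \<rho>" l] that by fastforce
  qed

  \<comment> \<open>on the sphere the model would exceed its value at \<open>0\<close>\<close>
  have "norm \<eta>' < \<rho>"
  proof (rule ccontr)
    assume "\<not> norm \<eta>' < \<rho>"
    then have t: "norm \<eta>' = \<rho>" using \<eta>'(2) by simp
    have "l \<eta>' \<le> g x" using min[OF subspace_0[OF V]] \<rho> S(2) by (simp add: l_def)
    moreover have "g x - g (x + \<eta>') \<le> K * \<rho>"
      using lipschitz_real_le[OF g, of x "x + \<eta>'"] by (simp add: t)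
    ultimately have "L / 2 * \<rho>\<^sup>2 \<le> (U + K) * \<rho> + K * \<kappa> * \<rho>\<^sup>2"
      using gS[OF \<eta>'] Gu[of \<eta>'] by (simp add: l_def t algebra_simps)
    then have "\<rho> * L \<le> \<rho> * (2 * K * \<kappa> + 2 * (U + K) / \<rho>)"
      using \<rho> by (simp add: field_simps power2_eq_square)
    then show False using L\<kappa>(1) \<rho> by simp
  qed
  moreover have "l \<eta>' \<le> l u" if "u \<in> V" "norm (u - \<eta>') < \<rho> - norm \<eta>'" for u
    using that norm_triangle_ineq[of \<eta>' "u - \<eta>'"] by (intro min) auto
  ultimately have stat: "stationary_point V l \<eta>'"
    using V \<eta>'(1) by (intro stationary_point_local_min[where e = "\<rho> - norm \<eta>'"]) auto

  define s where "s = norm (\<eta> - \<eta>')"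
  have "s \<le> q_tilde L K \<kappa> \<theta> \<phi> (norm \<eta>)"
  proof (cases "\<kappa> \<ge> 0")
    case True
    have "l \<eta>' \<le> l \<eta>" using min \<eta> \<eta>\<rho> by blast
    then have "G \<bullet> \<eta>' + L / 2 * (norm \<eta>')\<^sup>2 + g (x + \<eta>')
        \<le> G \<bullet> \<eta> + L / 2 * (norm \<eta>)\<^sup>2 + g (x + \<eta>) + K * \<kappa> * ((norm \<eta>)\<^sup>2 + (norm \<eta>')\<^sup>2)"
      using gS[OF \<eta>'] gS[OF \<eta> \<eta>\<rho>] by (simp add: l_def algebra_simps)
    moreover have "(norm \<eta>')\<^sup>2 = (norm \<eta>)\<^sup>2 + 2 * (\<eta> \<bullet> (\<eta>' - \<eta>)) + s\<^sup>2"
      by (simp add: s_def power2_norm_eq_inner inner_diff inner_commute)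
    then have "L / 2 * (norm \<eta>')\<^sup>2 = L / 2 * (norm \<eta>)\<^sup>2 + L * (\<eta> \<bullet> (\<eta>' - \<eta>)) + L / 2 * s\<^sup>2"
      by (simp add: distrib_left)
    moreover have "(G + L *\<^sub>R \<eta>) \<bullet> (\<eta>' - \<eta>) = G \<bullet> \<eta>' - G \<bullet> \<eta> + L * (\<eta> \<bullet> (\<eta>' - \<eta>))"
      by (simp add: inner_add_left inner_diff_right right_diff_distrib)
    moreover have "K * \<kappa> * (norm \<eta>')\<^sup>2 \<le> K * \<kappa> * (norm \<eta> + s)\<^sup>2"
      using norm_triangle_ineq[of \<eta> "\<eta>' - \<eta>"] K True
      by (intro mult_left_mono power_mono) (auto simp: s_def norm_minus_commute)
    ultimately have "L / 2 * s\<^sup>2 \<le> K * \<kappa> * ((norm \<eta>)\<^sup>2 + (norm \<eta> + s)\<^sup>2) + 2 * K * \<mu>"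
      using inexact[OF \<eta>'(1)] unfolding distrib_left by linarith
    then show ?thesis using L\<kappa>(2) \<mu> K \<theta> by (intro q_tilde_bound[where \<mu> = \<mu>])
  next
    \<comment> \<open>a negative \<open>\<kappa>\<close> is possible only if the ball in \<open>V\<close> is trivial\<close>
    case False
    have "u = 0" if "u \<in> V" "norm u \<le> \<rho>" for u
    proof (rule ccontr)
      assume "u \<noteq> 0"
      then have "\<kappa> * (norm u)\<^sup>2 < 0" using False by (intro mult_neg_pos) auto
      then show False using \<kappa>[OF that] norm_ge_zero[of "S u - x - u"] by linarith
    qed
    then have "\<eta> = 0" "\<eta>' = 0" using \<eta> \<eta>\<rho> \<eta>' by auto
    then show ?thesis by (simp add: s_def q_tilde_def \<phi>0)
  qed
  then show ?thesis using stat unfolding l_def s_def by blast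
qed

theorem theorem4p1:
  fixes M :: "'a::euclidean_space set" and r :: "('a \<times> 'a) set" and d :: nat
    and R :: "'a \<Rightarrow> 'a \<Rightarrow> 'a" and f g :: "'a \<Rightarrow> real" and x\<^sub>0 :: 'a
    and b :: "'a \<Rightarrow> nat \<Rightarrow> 'a" and \<phi> :: "real \<Rightarrow> real"
    and L\<^sub>g \<rho> \<kappa>\<^sub>2 U\<^sub>f :: real
  defines "T \<equiv> horizontal_space M r"
    and "k \<equiv> DIM('a) - d"
    and "\<Omega> \<equiv> sublevel_set M (\<lambda>x. f x + g x) x\<^sub>0"
  assumes manifold: "(embedded_submanifold M d \<and> r = Id_on M) \<or> riemannian_quotient M r d"
    and retraction: "retraction_on M r d R"
    and f_diff: "f differentiable_on M"
    and invariant: "f respects r" "g respects r"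
    and normal_basis: "\<forall>x\<in>M. orthonormal_basis_of ((T x)\<^sup>\<bottom>) k (b x)"
    and x0: "x\<^sub>0 \<in> M"
    and bounded_below: "bdd_below ((\<lambda>x. f x + g x) ` M)"
    and compact_sublevel: "compactin (quotient_topology M r) (\<Omega> // r)"
    and g_convex: "convex_on UNIV g"
    and g_lipschitz: "L\<^sub>g-lipschitz_on UNIV g"
    and rho_pos: "\<rho> > 0"
    and rho: "\<forall>x\<in>\<Omega>. \<Omega> \<subseteq> r `` (R x ` {\<xi>\<in>T x. norm \<xi> < \<rho>})"
    and kappa2: "\<forall>x\<in>\<Omega>. \<forall>\<eta>\<in>T x. norm \<eta> \<le> \<rho> \<longrightarrow> norm (R x \<eta> - x - \<eta>) \<le> \<kappa>\<^sub>2 * (norm \<eta>)\<^sup>2"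
    and U_f: "\<forall>x\<in>\<Omega>. norm (riem_grad M r f x) < U\<^sub>f"
    and phi: "mono \<phi>" "\<phi> 0 = 0"
  shows "\<exists>L\<^sub>0>0. \<forall>L>L\<^sub>0. \<forall>x\<in>\<Omega>. \<forall>\<Lambda>::nat \<Rightarrow> real.
    (let G = riem_grad M r f x;
         \<eta> = orth_proj (T x) (v_dir g L G k (b x) x \<Lambda>);
         \<theta> = U\<^sub>f + (\<rho> + 1) * L + L\<^sub>g
     in L2_set (Psi g L G k (b x) x \<Lambda>) {..<k} \<le> min (\<phi> (norm \<eta>)) (1 / 2) \<longrightarrow>
        (\<exists>\<eta>'. stationary_point (T x) (prox_objective M r R f g L x) \<eta>' \<and>
              norm (\<eta> - \<eta>') \<le> q_tilde L L\<^sub>g \<kappa>\<^sub>2 \<theta> \<phi> (norm \<eta>)))"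
proof -
  define L\<^sub>0 where "L\<^sub>0 = 2 * L\<^sub>g * \<bar>\<kappa>\<^sub>2\<bar> + 2 * (U\<^sub>f + L\<^sub>g) / \<rho> + L\<^sub>g / \<rho>\<^sup>2"
  have K: "L\<^sub>g \<ge> 0" using g_lipschitz by (rule lipschitz_on_nonneg)
  have "x\<^sub>0 \<in> \<Omega>" using x0 by (simp add: \<Omega>_def sublevel_set_def)
  then have U: "U\<^sub>f > 0" using U_f norm_ge_zero le_less_trans by blast
  then have "2 * (U\<^sub>f + L\<^sub>g) / \<rho> > 0" using K rho_pos by simp
  then have L0: "L\<^sub>0 > 0" using K by (simp add: L\<^sub>0_def add_nonneg_pos add_pos_nonneg)
  show ?thesis
    unfolding Let_def
  proof (intro exI[of _ L\<^sub>0] conjI allI ballI impI)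
    fix L x and \<Lambda> :: "nat \<Rightarrow> real"
    let ?G = "riem_grad M r f x"
    let ?\<eta> = "orth_proj (T x) (v_dir g L ?G k (b x) x \<Lambda>)"
    let ?\<mu> = "L2_set (Psi g L ?G k (b x) x \<Lambda>) {..<k}"
    assume L: "L\<^sub>0 < L" and x: "x \<in> \<Omega>" and \<mu>: "?\<mu> \<le> min (\<phi> (norm ?\<eta>)) (1 / 2)"
    have M: "x \<in> M" using x by (simp add: \<Omega>_def sublevel_set_def)
    have V: "subspace (T x)" unfolding T_def by (rule subspace_horizontal_space[OF manifold M])
    have b: "orthonormal_basis_of ((T x)\<^sup>\<bottom>) k (b x)" using normal_basis M by blast
    have "continuous_on (SIGMA x:M. T x) (\<lambda>(x, \<eta>). R x \<eta>)"
      using retraction unfolding retraction_on_def T_def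
      by (blast intro: smooth_map_on_imp_continuous_on)
    then have R: "continuous_on (T x) (\<lambda>u. (\<lambda>(x, \<eta>). R x \<eta>) (x, u))"
      by (rule continuous_on_compose2) (use M in \<open>auto intro!: continuous_intros\<close>)
    show "\<exists>\<eta>'. stationary_point (T x) (prox_objective M r R f g L x) \<eta>' \<and>
        norm (?\<eta> - \<eta>') \<le> q_tilde L L\<^sub>g \<kappa>\<^sub>2 (U\<^sub>f + (\<rho> + 1) * L + L\<^sub>g) \<phi> (norm ?\<eta>)"
      unfolding prox_objective_def[abs_def]
    proof (rule stationary_point_near_inexact_minimizer[OF g_lipschitz V])
      show "continuous_on (T x) (R x)" using R by simp
      show "R x 0 = x" using retraction M by (simp add: retraction_on_def)
      show "norm ?G \<le> U\<^sub>f" using U_f x by (simp add: less_imp_le)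
      show "?\<eta> \<in> T x" by (rule orth_proj_orthonormal_normal_basis(1)[OF V b])
      show "- 2 * L\<^sub>g * ?\<mu> \<le> (?G + L *\<^sub>R ?\<eta>) \<bullet> (u - ?\<eta>) + g (x + u) - g (x + ?\<eta>)"
        if "u \<in> T x" for u
        using L L0 that by (intro inexact_direction_variational[OF g_lipschitz g_convex _ V b]) auto
      show "L\<^sub>g \<le> U\<^sub>f + (\<rho> + 1) * L + L\<^sub>g" using U L L0 rho_pos by simp
      show "norm (R x u - x - u) \<le> \<kappa>\<^sub>2 * (norm u)\<^sup>2" if "u \<in> T x" "norm u \<le> \<rho>" for u
        using kappa2 x that by blast
    qed (use \<mu> L rho_pos phi in \<open>auto simp: L\<^sub>0_def L2_set_nonneg\<close>)
  qed (rule L0)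
qed

end
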